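(* Let $x_*\in X$ be an optimal solution of $\min_{x\in X}F(x)$ near which the bounds on $H_x$ and $g$ in the context hold with $\kappa_1+\kappa_2>0$. Let $\omega\ge0$, $\eta\ge0$ and $\tilde\omega_{\max}>0$. For $x\in X$ near $x_*$ let $\Delta s(\omega)=\Delta s_x(\omega)\in X$ be an inexact step at $x$, with $x_+(\omega):=x+\Delta s(\omega)$, which satisfies the two inexactness criteria $$\|\Delta x(\omega)-\Delta s(\omega)\|_X\le\eta\|\Delta x(\omega)\|_X ,\qquad \lambda_{x,\omega}(\Delta s(\omega))\le\lambda^\mu_{x,\tilde\omega}\big(\Delta x^\mu(\tilde\omega)\big)\ \text{ for some } 0<\tilde\omega<\tilde\omega_{\max},$$ where $\mu\in\partial_Fg(x)$ may depend on $x$. Suppose that $$\big(H_{x_+(\omega)}-H_x\big)\big(x_+(\omega)-x_*,\,x_+(\omega)-x_*\big)=o(\|x-x_*\|_X^2)\quad\text{as }x\to x_*,$$ and that $f$ is second order semi-smooth at $x_*$ with respect to $x\mapsto H_x$, i.e. $$f(x_*+\xi)=f(x_* )+f'(x_* )\xi+\tfrac12H_{x_*+\xi}(\xi,\xi)+o(\|\xi\|_X^2)\quad\text{as }\|\xi\|_X\to0 .$$ Then, for any $\gamma\in\,]0,1[$, the step $\Delta s(\omega)$ is admissible for sufficient decrease, i.e. $$F(x+\Delta s(\omega))-F(x)\le\gamma\,\lambda_{x,\omega}(\Delta s(\omega)),$$ provided $x$ is sufficiently close to $x_*$.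
   Context: $(X,\langle\cdot,\cdot\rangle_X)$ is a real Hilbert space with norm $\|\cdot\|_X$ and dual $X^*$. $F=f+g$ with $f,g:X\to\mathbb R$. The function $f$ is continuously differentiable and $f':X\to X^*$ is Lipschitz with constant $L_f>0$. The function $g$ is lower semi-continuous and there is $\kappa_2\in\mathbb R$ with $$g(sx+(1-s)y)\le s g(x)+(1-s)g(y)-\tfrac{\kappa_2}{2}s(1-s)\|x-y\|_X^2\quad\forall x,y\in X,\ s\in[0,1].$$ For each $x\in X$, $H_x\in\mathcal L(X,X^* )$ is a bounded linear operator identified with a symmetric bilinear form, and for $x$ near $x_*$ it satisfies $H_x(v,v)\ge\kappa_1\|v\|_X^2$ for all $v\in X$ with a constant $\kappa_1\in\mathbb R$. Moreover $f'$ is semi-smooth at $x_*$ with respect to $H_x$: $\|f'(x_* )-f'(x)-H_x(x_*-x)\|_{X^*}=o(\|x-x_*\|_X)$ as $x\to x_*$. For $x\in X$ and $\omega>-(\kappa_1+\kappa_2)$, $$\lambda_{x,\omega}(\delta x)=f'(x)\delta x+\tfrac12H_x(\delta x,\delta x)+\tfrac\omega2\|\delta x\|_X^2+g(x+\delta x)-g(x),\qquad \Delta x(\omega)=\operatorname*{argmin}_{\delta x\in X}\lambda_{x,\omega}(\delta x).$$ For $\mu\in\partial_Fg(x)$ and $\hat\omega>0$, $$\lambda^\mu_{x,\hat\omega}(\delta x)=f'(x)\delta x+\mu\,\delta x+\tfrac{\hat\omega}2\|\delta x\|_X^2,\qquad \Delta x^\mu(\hat\omega)=\operatorname*{argmin}_{\delta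 x\in X}\lambda^\mu_{x,\hat\omega}(\delta x).$$ $\partial_F$ denotes the Fréchet subdifferential: $\ell\in\partial_Fg(x)$ iff $\ell\in X^*$ and $\liminf_{v\to0}\frac{g(x+v)-g(x)-\ell(v)}{\|v\|_X}\ge0$. *)

theory Defs
  imports "HOL-Analysis.Analysis" "HOL-Library.Landau_Symbols"
begin

text \<open>
  Throughout, the dual space is \<^typ>\<open>'a \<Rightarrow>\<^sub>L real\<close>, so that \<^term>\<open>norm\<close> on it is the dual norm, and
  an operator from the space into its dual is an element of \<^typ>\<open>'a \<Rightarrow>\<^sub>L ('a \<Rightarrow>\<^sub>L real)\<close>,
  read as the bilinear form sending \<open>v, w\<close> to \<open>H v w\<close>.
\<close>

definition lower_semicontinuous :: "('a::topological_space \<Rightarrow> real) \<Rightarrow> bool" where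
  "lower_semicontinuous g \<longleftrightarrow>
     (\<forall>x. ereal (g x) \<le> Liminf (at x) (\<lambda>y. ereal (g y)))"

definition frechet_subdifferential ::
    "('a::real_normed_vector \<Rightarrow> real) \<Rightarrow> 'a \<Rightarrow> ('a \<Rightarrow>\<^sub>L real) set" where
  "frechet_subdifferential g x =
     {l. 0 \<le> Liminf (at 0) (\<lambda>v. ereal ((g (x + v) - g x - blinfun_apply l v) / norm v))}"

definition semismooth_at ::
    "('a::real_normed_vector \<Rightarrow> ('a \<Rightarrow>\<^sub>L real)) \<Rightarrow> ('a \<Rightarrow> ('a \<Rightarrow>\<^sub>L ('a \<Rightarrow>\<^sub>L real))) \<Rightarrow> 'a \<Rightarrow> bool" where
  "semismooth_at f' H xs \<longleftrightarrow>
     (\<lambda>x. norm (f' xs - f' x - blinfun_apply (H x) (xs - x))) \<in> o[at xs](\<lambda>x. norm (x - xs))"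

definition second_order_semismooth_at ::
    "('a::real_normed_vector \<Rightarrow> real) \<Rightarrow> ('a \<Rightarrow> ('a \<Rightarrow>\<^sub>L real)) \<Rightarrow>
     ('a \<Rightarrow> ('a \<Rightarrow>\<^sub>L ('a \<Rightarrow>\<^sub>L real))) \<Rightarrow> 'a \<Rightarrow> bool" where
  "second_order_semismooth_at f f' H xs \<longleftrightarrow>
     (\<lambda>\<xi>. f (xs + \<xi>) - (f xs + blinfun_apply (f' xs) \<xi>
            + 1/2 * blinfun_apply (blinfun_apply (H (xs + \<xi>)) \<xi>) \<xi>))
       \<in> o[at 0](\<lambda>\<xi>. (norm \<xi>)\<^sup>2)"

definition model ::
    "('a::real_normed_vector \<Rightarrow> ('a \<Rightarrow>\<^sub>L real)) \<Rightarrow> ('a \<Rightarrow> ('a \<Rightarrow>\<^sub>L ('a \<Rightarrow>\<^sub>L real))) \<Rightarrow>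
     ('a \<Rightarrow> real) \<Rightarrow> 'a \<Rightarrow> real \<Rightarrow> 'a \<Rightarrow> real" where
  "model f' H g x \<omega> d =
     blinfun_apply (f' x) d + 1/2 * blinfun_apply (blinfun_apply (H x) d) d
     + \<omega>/2 * (norm d)\<^sup>2 + g (x + d) - g x"

text \<open>
  \<^const>\<open>arg_min\<close> is a choice among the global minimizers. It denotes the exact step only where a
  minimizer exists, which for \<open>exact_step\<close> is the case when \<open>\<omega>\<close> exceeds the negative of the sum
  of the convexity moduli of \<open>H x\<close> and \<open>g\<close>, and for \<open>subgradient_step\<close> when \<open>\<omega> > 0\<close>;
  in both cases it is unique.
\<close>

definition exact_step ::
    "('a::real_normed_vector \<Rightarrow> ('a \<Rightarrow>\<^sub>L real)) \<Rightarrow> ('a \<Rightarrow> ('a \<Rightarrow>\<^sub>L ('a \<Rightarrow>\<^sub>L real))) \<Rightarrow>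
     ('a \<Rightarrow> real) \<Rightarrow> 'a \<Rightarrow> real \<Rightarrow> 'a" where
  "exact_step f' H g x \<omega> = arg_min (model f' H g x \<omega>) (\<lambda>_. True)"

definition subgradient_model ::
    "('a::real_normed_vector \<Rightarrow> ('a \<Rightarrow>\<^sub>L real)) \<Rightarrow> ('a \<Rightarrow>\<^sub>L real) \<Rightarrow> 'a \<Rightarrow> real \<Rightarrow> 'a \<Rightarrow> real" where
  "subgradient_model f' \<mu> x \<omega> d =
     blinfun_apply (f' x) d + blinfun_apply \<mu> d + \<omega>/2 * (norm d)\<^sup>2"

definition subgradient_step ::
    "('a::real_normed_vector \<Rightarrow> ('a \<Rightarrow>\<^sub>L real)) \<Rightarrow> ('a \<Rightarrow>\<^sub>L real) \<Rightarrow> 'a \<Rightarrow> real \<Rightarrow> 'a" where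
  "subgradient_step f' \<mu> x \<omega> = arg_min (subgradient_model f' \<mu> x \<omega>) (\<lambda>_. True)"

end

theory Submission
  imports Defs
begin

text \<open>
  Write \<open>u = x - x\<^sub>*\<close>. Strong convexity turns Frechet subgradients into global quadratic lower
  bounds; by optimality \<open>- f'(x\<^sub>*)\<close> is such a subgradient of \<open>g\<close> at \<open>x\<^sub>*\<close>. Comparing the exact
  step with the step \<open>- u\<close> to the solution gives \<open>\<parallel>\<Delta>s\<parallel> = O(\<parallel>u\<parallel>)\<close>, and comparing the subgradient
  step with a short step \<open>- t u\<close> gives \<open>\<lambda>(\<Delta>s) \<le> - c \<parallel>u\<parallel>\<^sup>2\<close>, where \<open>c > 0\<close> does not depend on \<open>x\<close>.
  Expanding \<open>f\<close> to second order at \<open>x\<^sub>*\<close>, at both \<open>x\<close> and \<open>x + \<Delta>s\<close>, shows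
  \<open>F(x + \<Delta>s) - F(x) \<le> \<lambda>(\<Delta>s) + o(\<parallel>u\<parallel>\<^sup>2)\<close>, and the error is absorbed by \<open>(1 - \<gamma>) \<lambda>(\<Delta>s)\<close>.
\<close>

section \<open>Lower semicontinuity\<close>

text \<open>Trades the extended-real \<open>Liminf\<close> for real inequalities. The filter can be
  \<open>nhds x\<close> instead of the punctured \<open>at x\<close>, because \<open>c < g x\<close>
  is the inequality at the centre itself.\<close>

lemma lower_semicontinuous_iff:
  "lower_semicontinuous g \<longleftrightarrow> (\<forall>x c. c < g x \<longrightarrow> (\<forall>\<^sub>F y in nhds x. c < g y))"
proof -
  have "ereal (g x) \<le> Liminf (at x) (\<lambda>y. ereal (g y)) \<longleftrightarrow>
      (\<forall>c. c < g x \<longrightarrow> (\<forall>\<^sub>F y in nhds x. c < g y))" for x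
  proof
    assume *: "ereal (g x) \<le> Liminf (at x) (\<lambda>y. ereal (g y))"
    show "\<forall>c. c < g x \<longrightarrow> (\<forall>\<^sub>F y in nhds x. c < g y)"
    proof (intro allI impI)
      fix c assume c: "c < g x"
      then have "ereal c < ereal (g x)" by simp
      then have "\<forall>\<^sub>F y in at x. ereal c < ereal (g y)"
        using * unfolding le_Liminf_iff by blast
      then show "\<forall>\<^sub>F y in nhds x. c < g y"
        using c by (auto simp: eventually_nhds_conv_at)
    qed
  next
    assume *: "\<forall>c. c < g x \<longrightarrow> (\<forall>\<^sub>F y in nhds x. c < g y)"
    show "ereal (g x) \<le> Liminf (at x) (\<lambda>y. ereal (g y))"
      unfolding le_Liminf_iff
    proof (intro allI impI)
      fix c assume "c < ereal (g x)"
      then show "\<forall>\<^sub>F y in at x. c < ereal (g y)"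
        using * by (cases c) (auto simp: eventually_nhds_conv_at)
    qed
  qed
  then show ?thesis unfolding lower_semicontinuous_def by auto
qed

lemma lower_semicontinuous_continuous_add:
  fixes q g :: "'a::real_normed_vector \<Rightarrow> real"
  assumes q: "continuous_on UNIV q" and g: "lower_semicontinuous g"
  shows "lower_semicontinuous (\<lambda>d. q d + g (x + d))"
  unfolding lower_semicontinuous_iff
proof (intro allI impI)
  fix d c assume c: "c < q d + g (x + d)"
  \<comment> \<open>Half of the gap: each of the two summands may lose \<open>e\<close>.\<close>
  define e where "e = (q d + g (x + d) - c) / 2"
  have e: "e > 0" using c by (simp add: e_def)
  have "(q \<longlongrightarrow> q d) (nhds d)"
    using q by (simp add: continuous_on_eq_continuous_at isCont_def tendsto_at_iff_tendsto_nhds)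
  then have 1: "\<forall>\<^sub>F y in nhds d. q d - e < q y"
    using e by (intro order_tendstoD) auto
  have "filterlim (\<lambda>y. x + y) (nhds (x + d)) (nhds d)"
    by (intro tendsto_intros filterlim_ident)
  moreover have "\<forall>\<^sub>F z in nhds (x + d). g (x + d) - e < g z"
    using g e unfolding lower_semicontinuous_iff by auto
  ultimately have 2: "\<forall>\<^sub>F y in nhds d. g (x + d) - e < g (x + y)"
    by (rule eventually_compose_filterlim[rotated])
  show "\<forall>\<^sub>F y in nhds d. c < q y + g (x + y)"
    using 1 2 by eventually_elim (simp add: e_def field_simps)
qed

section \<open>Strong convexity and existence of minimizers\<close>

text \<open>The modulus \<open>m\<close> may be negative, so that weakly convex functions are
  covered too; only \<open>\<kappa>\<^sub>1 + \<kappa>\<^sub>2\<close> is known to be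
  positive.\<close>

definition strongly_convex :: "real \<Rightarrow> ('a::real_normed_vector \<Rightarrow> real) \<Rightarrow> bool" where
  "strongly_convex m g \<longleftrightarrow>
     (\<forall>x y s. 0 \<le> s \<longrightarrow> s \<le> 1 \<longrightarrow>
        g (s *\<^sub>R x + (1 - s) *\<^sub>R y)
          \<le> s * g x + (1 - s) * g y - m / 2 * s * (1 - s) * (norm (x - y))\<^sup>2)"

lemma strongly_convexD:
  "strongly_convex m g \<Longrightarrow> 0 \<le> s \<Longrightarrow> s \<le> 1 \<Longrightarrow>
     g (s *\<^sub>R x + (1 - s) *\<^sub>R y)
       \<le> s * g x + (1 - s) * g y - m / 2 * s * (1 - s) * (norm (x - y))\<^sup>2"
  by (simp add: strongly_convex_def)

text \<open>Lower semicontinuity bounds \<open>\<phi>\<close> below on a ball around 0. For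
  \<open>y\<close> outside, strong convexity on the segment from 0 to \<open>y\<close> carries this
  bound outwards with a gain quadratic in \<open>norm y\<close>, which beats the linear
  loss.\<close>

lemma strongly_convex_bounded_below:
  fixes \<phi> :: "'a::real_normed_vector \<Rightarrow> real"
  assumes cvx: "strongly_convex m \<phi>" and m: "m > 0" and lsc: "lower_semicontinuous \<phi>"
  shows "bdd_below (range \<phi>)"
proof -
  have "\<forall>\<^sub>F y in nhds 0. \<phi> 0 - 1 < \<phi> y"
    using lsc unfolding lower_semicontinuous_iff by auto
  then obtain r where r: "r > 0" "\<And>y. norm y < r \<Longrightarrow> \<phi> 0 - 1 < \<phi> y"
    unfolding eventually_nhds_metric by auto
  \<comment> \<open>With \<open>norm y = t * \<rho>\<close>, the point
    \<open>(1 / t) *\<^sub>R y\<close> has norm \<open>\<rho>\<close>, strictly inside the ball, and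
    \<open>a\<close> becomes the coefficient of \<open>t\<^sup>2\<close>.\<close>
  define \<rho> where "\<rho> = r / 2"
  define a where "a = m / 2 * \<rho>\<^sup>2"
  have \<rho>: "\<rho> > 0" "\<rho> < r" and a: "a > 0" using r m by (auto simp: \<rho>_def a_def)
  \<comment> \<open>The last term is the maximum over \<open>t\<close> of
    \<open>(a + 1) * t - a * t\<^sup>2\<close>; the square completed below shows this.\<close>
  have "\<phi> y \<ge> \<phi> 0 - 1 - (a + 1)\<^sup>2 / (4 * a)" for y
  proof (cases "norm y < r")
    case True
    have "0 \<le> (a + 1)\<^sup>2 / (4 * a)" using a by simp
    then show ?thesis using r(2)[OF True] by linarith
  next
    case False
    define t where "t = norm y / \<rho>"
    have t: "t \<ge> 1" "norm y = t * \<rho>" using False \<rho> by (auto simp: t_def field_simps)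
    have "norm ((1 / t) *\<^sub>R y) < r" using t \<rho> by simp
    then have "\<phi> 0 - 1 < \<phi> ((1 / t) *\<^sub>R y + (1 - 1 / t) *\<^sub>R 0)" using r(2) by simp
    also have "\<dots> \<le> 1 / t * \<phi> y + (1 - 1 / t) * \<phi> 0 - m / 2 * (1 / t) * (1 - 1 / t) * (norm (y - 0))\<^sup>2"
      using t by (intro strongly_convexD[OF cvx]) auto
    also have "\<dots> = (\<phi> y + (t - 1) * \<phi> 0 - a * (t\<^sup>2 - t)) / t"
      using t by (simp add: a_def field_simps power2_eq_square)
    finally have "t * (\<phi> 0 - 1) < \<phi> y + (t - 1) * \<phi> 0 - a * (t\<^sup>2 - t)"
      using t by (simp add: field_simps)
    then have 1: "\<phi> y > \<phi> 0 + (a * t\<^sup>2 - (a + 1) * t)" by (simp add: algebra_simps)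
    have "0 \<le> (2 * a * t - (a + 1))\<^sup>2 / (4 * a)" using a by simp
    also have "\<dots> = (a * t\<^sup>2 - (a + 1) * t) + (a + 1)\<^sup>2 / (4 * a)"
      using a by (simp add: field_simps power2_eq_square)
    finally show ?thesis using 1 by linarith
  qed
  then show ?thesis by (intro bdd_belowI2)
qed

text \<open>Strong convexity makes every minimizing sequence Cauchy in norm, so completeness gives a
  limit without any weak compactness, and lower semicontinuity makes the limit a minimizer.\<close>

lemma strongly_convex_has_minimizer:
  fixes \<phi> :: "'a::{real_normed_vector, complete_space} \<Rightarrow> real"
  assumes cvx: "strongly_convex m \<phi>" and m: "m > 0" and lsc: "lower_semicontinuous \<phi>"
  shows "\<exists>p. is_arg_min \<phi> (\<lambda>_. True) p"
proof -
  define c where "c = Inf (range \<phi>)"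
  note bdd = strongly_convex_bounded_below[OF assms]
  have c_le: "c \<le> \<phi> y" for y unfolding c_def using bdd by (intro cInf_lower) auto
  have "\<exists>y. \<phi> y < c + inverse (real (Suc n))" for n
    using cInf_lessD[of "range \<phi>" "c + inverse (real (Suc n))"] by (auto simp: c_def)
  then obtain X where X: "\<And>n. \<phi> (X n) < c + inverse (real (Suc n))" by metis
  have close: "(norm (X i - X j))\<^sup>2 \<le> 4 / m * (inverse (real (Suc i)) + inverse (real (Suc j)))" for i j
  proof -
    \<comment> \<open>The midpoint cannot fall below the infimum, so the convexity gain
      \<open>m / 8\<close> times the squared distance is at most the mean excess of the two values
      over \<open>c\<close>.\<close>
    have "c \<le> \<phi> ((1/2) *\<^sub>R X i + (1 - 1/2) *\<^sub>R X j)" by (rule c_le)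
    also have "\<dots> \<le> 1/2 * \<phi> (X i) + (1 - 1/2) * \<phi> (X j) - m / 2 * (1/2) * (1 - 1/2) * (norm (X i - X j))\<^sup>2"
      by (intro strongly_convexD[OF cvx]) auto
    finally have "m * (norm (X i - X j))\<^sup>2 \<le> 4 * (inverse (real (Suc i)) + inverse (real (Suc j)))"
      using X[of i] X[of j] by simp
    then show ?thesis using m by (simp only: times_divide_eq_left pos_le_divide_eq mult.commute)
  qed
  have "Cauchy X"
  proof (rule CauchyI)
    fix e :: real assume e: "e > 0"
    have "m * e\<^sup>2 / 8 > 0" using e m by simp
    then obtain N where N: "inverse (real (Suc N)) < m * e\<^sup>2 / 8" using reals_Archimedean by blast
    have *: "inverse (real (Suc n)) < m * e\<^sup>2 / 8" if "n \<ge> N" for n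
    proof -
      have "inverse (real (Suc n)) \<le> inverse (real (Suc N))"
        using that by (intro le_imp_inverse_le) auto
      then show ?thesis using N by linarith
    qed
    have "norm (X i - X j) < e" if "i \<ge> N" "j \<ge> N" for i j
    proof -
      have "(norm (X i - X j))\<^sup>2 \<le> 4 / m * (inverse (real (Suc i)) + inverse (real (Suc j)))" by (rule close)
      also have "\<dots> < 4 / m * (m * e\<^sup>2 / 8 + m * e\<^sup>2 / 8)"
        using m *[OF that(1)] *[OF that(2)] by (intro mult_strict_left_mono add_strict_mono) auto
      also have "\<dots> = e\<^sup>2" using m by simp
      finally show ?thesis using e by (simp add: power_less_imp_less_base)
    qed
    then show "\<exists>M. \<forall>i\<ge>M. \<forall>j\<ge>M. norm (X i - X j) < e" by blast
  qed
  then obtain p where p: "X \<longlonglongrightarrow> p" using Cauchy_convergent_iff convergent_def by blast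
  have "\<phi> p \<le> c"
  proof (rule ccontr)
    assume "\<not> \<phi> p \<le> c"
    then have *: "c < (c + \<phi> p) / 2" "(c + \<phi> p) / 2 < \<phi> p" by auto
    have "\<forall>\<^sub>F y in nhds p. (c + \<phi> p) / 2 < \<phi> y"
      using lsc * unfolding lower_semicontinuous_iff by blast
    then have 1: "\<forall>\<^sub>F n in sequentially. (c + \<phi> p) / 2 < \<phi> (X n)"
      using p by (rule eventually_compose_filterlim)
    have "(\<lambda>n. c + inverse (real (Suc n))) \<longlonglongrightarrow> c + 0"
      by (intro tendsto_intros LIMSEQ_inverse_real_of_nat)
    then have 2: "\<forall>\<^sub>F n in sequentially. c + inverse (real (Suc n)) < (c + \<phi> p) / 2"
      using * by (intro order_tendstoD) auto
    have "\<forall>\<^sub>F n in sequentially. False"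
      using 1 2
    proof eventually_elim
      case (elim n)
      then show ?case using X[of n] by linarith
    qed
    then show False by simp
  qed
  then show ?thesis using c_le unfolding is_arg_min_def by (metis not_less order_trans)
qed

section \<open>Frechet subgradients\<close>

lemma frechet_subdifferential_iff:
  "l \<in> frechet_subdifferential g x \<longleftrightarrow>
     (\<forall>e>0. \<forall>\<^sub>F v in at 0. g (x + v) - g x - blinfun_apply l v > - e * norm v)"
proof -
  have *: "c < (g (x + v) - g x - blinfun_apply l v) / norm v \<longleftrightarrow>
      c * norm v < g (x + v) - g x - blinfun_apply l v" if "v \<noteq> 0" for c v
    using that by (simp add: pos_less_divide_eq)
  have neg: "(\<forall>c<0. P c) \<longleftrightarrow> (\<forall>e>0. P (- e))" for P :: "real \<Rightarrow> bool"
  proof (intro iffI allI impI)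
    fix c :: real assume "\<forall>e>0. P (- e)" "c < 0"
    then have "P (- (- c))" by (metis neg_0_less_iff_less)
    then show "P c" by simp
  qed auto
  have "l \<in> frechet_subdifferential g x \<longleftrightarrow>
    (\<forall>c<0. \<forall>\<^sub>F v in at 0. c < (g (x + v) - g x - blinfun_apply l v) / norm v)" (is "_ \<longleftrightarrow> ?R")
    unfolding frechet_subdifferential_def mem_Collect_eq le_Liminf_iff
  proof (intro iffI allI impI)
    fix c :: real assume *: "\<forall>y<0. \<forall>\<^sub>F v in at 0. y < ereal ((g (x + v) - g x - blinfun_apply l v) / norm v)" and c: "c < 0"
    show "\<forall>\<^sub>F v in at 0. c < (g (x + v) - g x - blinfun_apply l v) / norm v"
      using *[rule_format, of "ereal c"] c by simp
  next
    fix c :: ereal assume "?R" "c < 0"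
    then show "\<forall>\<^sub>F v in at 0. c < ereal ((g (x + v) - g x - blinfun_apply l v) / norm v)"
      by (cases c) auto
  qed
  also have "\<dots> \<longleftrightarrow> (\<forall>c<0. \<forall>\<^sub>F v in at 0. c * norm v < g (x + v) - g x - blinfun_apply l v)"
    by (simp add: eventually_at_filter * cong: imp_cong)
  also have "\<dots> \<longleftrightarrow> (\<forall>e>0. \<forall>\<^sub>F v in at 0. - e * norm v < g (x + v) - g x - blinfun_apply l v)"
    by (rule neg)
  finally show ?thesis .
qed

text \<open>Passes from local to global: on the segment from \<open>x\<close> to \<open>y\<close>
  the Frechet inequality bounds \<open>g\<close> below and convexity bounds it above. Dividing by
  the segment parameter \<open>s\<close> and letting it tend to 0 leaves the full modulus
  \<open>m / 2\<close>.\<close>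

lemma strongly_convex_subgradient_bound:
  fixes g :: "'a::real_normed_vector \<Rightarrow> real"
  assumes cvx: "strongly_convex m g" and l: "l \<in> frechet_subdifferential g x"
  shows "g y \<ge> g x + blinfun_apply l (y - x) + m / 2 * (norm (y - x))\<^sup>2"
proof (cases "y = x")
  case False
  define w where "w = y - x"
  have w: "norm w > 0" "y = x + w" using False by (auto simp: w_def)
  have "m / 2 * (norm w)\<^sup>2 \<le> g y - g x - blinfun_apply l w + e" if e: "e > 0" for e
  proof -
    \<comment> \<open>With this tolerance the Frechet error at \<open>s *\<^sub>R w\<close> is
      exactly \<open>s * e\<close>, which becomes \<open>e\<close> after division by
      \<open>s\<close>.\<close>
    have "e / norm w > 0" using e w by simp
    then have "\<forall>\<^sub>F v in at 0. g (x + v) - g x - blinfun_apply l v > - (e / norm w) * norm v"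
      using l unfolding frechet_subdifferential_iff by blast
    moreover have "filterlim (\<lambda>s. s *\<^sub>R w) (at 0) (at_right (0::real))"
      unfolding filterlim_at
    proof
      show "\<forall>\<^sub>F s in at_right 0. s *\<^sub>R w \<in> UNIV \<and> s *\<^sub>R w \<noteq> 0"
        using w by (auto simp: eventually_at_filter)
      have "((\<lambda>s. s *\<^sub>R w) \<longlongrightarrow> 0 *\<^sub>R w) (at_right (0::real))" by (intro tendsto_intros)
      then show "((\<lambda>s. s *\<^sub>R w) \<longlongrightarrow> 0) (at_right (0::real))" by simp
    qed
    ultimately have 1: "\<forall>\<^sub>F s in at_right 0. g (x + s *\<^sub>R w) - g x - blinfun_apply l (s *\<^sub>R w) > - (e / norm w) * norm (s *\<^sub>R w)"
      unfolding filterlim_iff by blast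
    have 2: "\<forall>\<^sub>F s in at_right 0. (0::real) < s \<and> s < 1"
      by (auto simp: eventually_at_right_field intro: exI[of _ 1])
    have "\<forall>\<^sub>F s in at_right 0. m / 2 * (1 - s) * (norm w)\<^sup>2 \<le> g y - g x - blinfun_apply l w + e"
      using 1 2
    proof eventually_elim
      case (elim s)
      have "s *\<^sub>R y + (1 - s) *\<^sub>R x = x + s *\<^sub>R w" by (simp add: w algebra_simps)
      then have "g (x + s *\<^sub>R w) \<le> s * g y + (1 - s) * g x - m / 2 * s * (1 - s) * (norm w)\<^sup>2"
        using strongly_convexD[OF cvx, of s y x] elim by (simp add: w_def)
      moreover have "(e / norm w) * norm (s *\<^sub>R w) = s * e" using w elim by simp
      ultimately have "s * (m / 2 * (1 - s) * (norm w)\<^sup>2) \<le> s * (g y - g x - blinfun_apply l w + e)"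
        using elim by (simp add: blinfun.scaleR_right algebra_simps)
      then show ?case using elim by simp
    qed
    moreover have "((\<lambda>s. m / 2 * (1 - s) * (norm w)\<^sup>2) \<longlongrightarrow> m / 2 * (1 - 0) * (norm w)\<^sup>2) (at_right 0)"
      by (intro tendsto_intros)
    ultimately show ?thesis by (intro tendsto_upperbound[where F = "at_right 0"]) auto
  qed
  then have "m / 2 * (norm w)\<^sup>2 \<le> g y - g x - blinfun_apply l w" by (rule field_le_epsilon)
  then show ?thesis by (simp add: w_def)
qed simp

text \<open>Fermat's rule. Combined with \<open>strongly_convex_subgradient_bound\<close> it yields
  quadratic growth of the model around its minimizer.\<close>

lemma minimizer_zero_subgradient:
  "is_arg_min \<phi> (\<lambda>_. True) p \<Longrightarrow> 0 \<in> frechet_subdifferential \<phi> p"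
  unfolding frechet_subdifferential_iff
proof (intro allI impI)
  fix e :: real assume e: "e > 0" and min: "is_arg_min \<phi> (\<lambda>_. True) p"
  have "- e * norm v < \<phi> (p + v) - \<phi> p - blinfun_apply 0 v" if "v \<noteq> 0" for v
  proof -
    have "\<phi> p \<le> \<phi> (p + v)" "0 < e * norm v"
      using min e that by (auto simp: is_arg_min_def not_less)
    then show ?thesis by simp
  qed
  then show "\<forall>\<^sub>F v in at 0. - e * norm v < \<phi> (p + v) - \<phi> p - blinfun_apply 0 v"
    by (simp add: eventually_at_filter)
qed

lemma abs_blinfun_apply_le:
  fixes l :: "'a::real_normed_vector \<Rightarrow>\<^sub>L real"
  shows "norm l \<le> c \<Longrightarrow> \<bar>blinfun_apply l v\<bar> \<le> c * norm v"
  using norm_blinfun[of l v] mult_right_mono[of "norm l" c "norm v"] by simp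

text \<open>Fermat's rule for a differentiable plus a nonsmooth term: by minimality \<open>g\<close>
  decreases at most as much as \<open>f\<close> increases, and the increase of \<open>f\<close> is
  \<open>l\<close> up to first order.\<close>

lemma minimizer_sum_subgradient:
  assumes min: "is_arg_min (\<lambda>x. f x + g x) (\<lambda>_. True) x"
    and deriv: "(f has_derivative blinfun_apply l) (at x)"
  shows "- l \<in> frechet_subdifferential g x"
  unfolding frechet_subdifferential_iff
proof (intro allI impI)
  fix e :: real assume e: "e > 0"
  have "((\<lambda>v. norm (f (x + v) - f x - blinfun_apply l v) / norm v) \<longlongrightarrow> 0) (at 0)"
    using deriv by (simp add: has_derivative_at)
  then have "\<forall>\<^sub>F v in at 0. norm (f (x + v) - f x - blinfun_apply l v) / norm v < e"
    using e by (intro order_tendstoD)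
  moreover have "\<forall>\<^sub>F v in at 0. v \<noteq> (0::'a)" by (simp add: eventually_at_filter)
  ultimately show "\<forall>\<^sub>F v in at 0. g (x + v) - g x - blinfun_apply (- l) v > - e * norm v"
  proof eventually_elim
    case (elim v)
    then have "\<bar>f (x + v) - f x - blinfun_apply l v\<bar> < e * norm v" by (simp add: field_simps)
    moreover have "f x + g x \<le> f (x + v) + g (x + v)"
      using min by (auto simp: is_arg_min_def not_less)
    ultimately show ?case by (simp add: blinfun.minus_left)
  qed
qed

section \<open>The models and their minimizers\<close>

text \<open>A quadratic form satisfies the convexity relation with equality, its value at
  \<open>a - b\<close> being the defect. Hence the moduli of \<open>H x\<close>, of \<open>g\<close>
  and of the regularization add up.\<close>

lemma strongly_convex_model:
  fixes g :: "'a::real_inner \<Rightarrow> real"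
  assumes g: "strongly_convex k g"
    and H: "\<And>v. blinfun_apply (blinfun_apply (H x) v) v \<ge> h * (norm v)\<^sup>2"
  shows "strongly_convex (h + k + \<omega>) (model f' H g x \<omega>)"
  unfolding strongly_convex_def
proof (intro allI impI)
  fix a b :: 'a and s :: real assume s: "0 \<le> s" "s \<le> 1"
  define c where "c = s *\<^sub>R a + (1 - s) *\<^sub>R b"
  have "x + c = s *\<^sub>R (x + a) + (1 - s) *\<^sub>R (x + b)" by (simp add: c_def algebra_simps)
  then have 1: "g (x + c) \<le> s * g (x + a) + (1 - s) * g (x + b) - k / 2 * s * (1 - s) * (norm (a - b))\<^sup>2"
    using strongly_convexD[OF g s, of "x + a" "x + b"] by simp
  have 2: "blinfun_apply (f' x) c = s * blinfun_apply (f' x) a + (1 - s) * blinfun_apply (f' x) b"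
    by (simp add: c_def blinfun.add_right blinfun.scaleR_right)
  have 3: "blinfun_apply (blinfun_apply (H x) c) c
      = s * blinfun_apply (blinfun_apply (H x) a) a + (1 - s) * blinfun_apply (blinfun_apply (H x) b) b
        - s * (1 - s) * blinfun_apply (blinfun_apply (H x) (a - b)) (a - b)"
    by (simp add: c_def blinfun.bilinear_simps) (simp add: algebra_simps)
  have 4: "(norm c)\<^sup>2 = s * (norm a)\<^sup>2 + (1 - s) * (norm b)\<^sup>2 - s * (1 - s) * (norm (a - b))\<^sup>2"
    by (simp add: c_def power2_norm_eq_inner inner_add_left inner_add_right inner_diff_left inner_diff_right inner_commute)
       (simp add: algebra_simps)
  have 5: "s * (1 - s) * (h * (norm (a - b))\<^sup>2) \<le> s * (1 - s) * blinfun_apply (blinfun_apply (H x) (a - b)) (a - b)"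
    using s H by (intro mult_left_mono) auto
  show "model f' H g x \<omega> (s *\<^sub>R a + (1 - s) *\<^sub>R b)
      \<le> s * model f' H g x \<omega> a + (1 - s) * model f' H g x \<omega> b
        - (h + k + \<omega>) / 2 * s * (1 - s) * (norm (a - b))\<^sup>2"
    unfolding c_def[symmetric] model_def 2 3 4 using 1 5 by (simp add: algebra_simps add_divide_distrib diff_divide_distrib)
qed

lemma lower_semicontinuous_model:
  assumes "lower_semicontinuous g"
  shows "lower_semicontinuous (model f' H g x \<omega>)"
proof -
  let ?q = "\<lambda>d. blinfun_apply (f' x) d + 1/2 * blinfun_apply (blinfun_apply (H x) d) d
     + \<omega>/2 * (norm d)\<^sup>2 - g x"
  have "lower_semicontinuous (\<lambda>d. ?q d + g (x + d))"
    by (intro lower_semicontinuous_continuous_add assms continuous_intros)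
  moreover have "model f' H g x \<omega> = (\<lambda>d. ?q d + g (x + d))"
    by (simp add: model_def fun_eq_iff)
  ultimately show ?thesis by simp
qed

lemma is_arg_min_exact_step:
  fixes g :: "'a::{real_inner, complete_space} \<Rightarrow> real"
  assumes "strongly_convex k g" "lower_semicontinuous g"
    and "\<And>v. blinfun_apply (blinfun_apply (H x) v) v \<ge> h * (norm v)\<^sup>2"
    and "h + k + \<omega> > 0"
  shows "is_arg_min (model f' H g x \<omega>) (\<lambda>_. True) (exact_step f' H g x \<omega>)"
  unfolding exact_step_def arg_min_def
  using strongly_convex_has_minimizer[OF strongly_convex_model[where H = H and x = x, OF assms(1,3)] assms(4)
      lower_semicontinuous_model[OF assms(2)]]
  by (rule someI_ex)

lemma is_arg_min_subgradient_step:
  fixes f' :: "'a::{real_inner, complete_space} \<Rightarrow> 'a \<Rightarrow>\<^sub>L real"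
  assumes "\<omega> > 0"
  shows "is_arg_min (subgradient_model f' \<mu> x \<omega>) (\<lambda>_. True) (subgradient_step f' \<mu> x \<omega>)"
proof -
  \<comment> \<open>The subgradient model is an instance of the full model: derivative
    \<open>f' x + \<mu>\<close>, zero Hessian and zero nonsmooth part.\<close>
  have eq: "subgradient_model f' \<mu> x \<omega> = model (\<lambda>_. f' x + \<mu>) (\<lambda>_. 0) (\<lambda>_. 0) x \<omega>"
    by (simp add: fun_eq_iff subgradient_model_def model_def blinfun.add_left)
  have "strongly_convex 0 (\<lambda>_::'a. 0)" "lower_semicontinuous (\<lambda>_::'a. 0)"
    by (auto simp: strongly_convex_def lower_semicontinuous_iff)
  then have "is_arg_min (subgradient_model f' \<mu> x \<omega>) (\<lambda>_. True)
      (exact_step (\<lambda>_. f' x + \<mu>) (\<lambda>_. 0) (\<lambda>_. 0) x \<omega>)"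
    unfolding eq using assms by (intro is_arg_min_exact_step[where h = 0 and k = 0]) auto
  then show ?thesis
    unfolding subgradient_step_def arg_min_def by (rule someI)
qed

section \<open>Estimates for the two steps\<close>

text \<open>Two quadratic growth bounds are added: the model around its minimizer, tested at the
  step to \<open>xs\<close>, and \<open>g\<close> around \<open>xs\<close>, tested at the new
  iterate. What remains is the semismoothness residual and the regularization, both paired with the
  new error \<open>p\<close>; dividing by \<open>norm p\<close> gives the claim.\<close>

lemma exact_step_error_bound:
  fixes g :: "'a::{real_inner, complete_space} \<Rightarrow> real"
  assumes cvx: "strongly_convex k g" and lsc: "lower_semicontinuous g"
    and sym: "\<And>v w. blinfun_apply (blinfun_apply (H x) v) w = blinfun_apply (blinfun_apply (H x) w) v"
    and H: "\<And>v. blinfun_apply (blinfun_apply (H x) v) v \<ge> h * (norm v)\<^sup>2"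
    and pos: "h + k + \<omega> > 0" and \<omega>: "\<omega> \<ge> 0"
    and opt: "- f' xs \<in> frechet_subdifferential g xs"
    and err: "norm (f' xs - f' x - blinfun_apply (H x) (xs - x)) \<le> e * norm (x - xs)"
  shows "(h + k + \<omega>) * norm (x + exact_step f' H g x \<omega> - xs) \<le> (e + \<omega>) * norm (x - xs)"
proof -
  define d where "d = exact_step f' H g x \<omega>"
  define u where "u = x - xs"
  define p where "p = x + d - xs"
  let ?m = "h + k + \<omega>"
  have d: "d = p - u" "x + d = xs + p" "xs - x = - u" by (auto simp: p_def u_def)
  have "model f' H g x \<omega> (- u) \<ge> model f' H g x \<omega> d + blinfun_apply 0 (- u - d) + ?m / 2 * (norm (- u - d))\<^sup>2"
    unfolding d_def
    using cvx lsc H pos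
    by (intro strongly_convex_subgradient_bound strongly_convex_model minimizer_zero_subgradient
        is_arg_min_exact_step)
  moreover have "norm (- u - d) = norm p" unfolding d by simp
  ultimately have 1: "model f' H g x \<omega> (- u) \<ge> model f' H g x \<omega> d + ?m / 2 * (norm p)\<^sup>2"
    by simp
  have 2: "g (x + d) \<ge> g xs + blinfun_apply (- f' xs) p + k / 2 * (norm p)\<^sup>2"
    using strongly_convex_subgradient_bound[OF cvx opt, of "x + d"] by (simp add: p_def)
  have xu: "x + - u = xs" by (simp add: u_def)
  have Hd: "blinfun_apply (blinfun_apply (H x) d) d = blinfun_apply (blinfun_apply (H x) p) p
      - 2 * blinfun_apply (blinfun_apply (H x) u) p + blinfun_apply (blinfun_apply (H x) u) u"
    using sym[of p u] by (simp add: d(1) blinfun.bilinear_simps)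
  have nd: "(norm d)\<^sup>2 = (norm p)\<^sup>2 - 2 * inner u p + (norm u)\<^sup>2"
    by (simp add: d(1) power2_norm_eq_inner inner_diff_left inner_diff_right inner_commute)
  \<comment> \<open>The first-order terms and the cross term of \<open>H x\<close> left over from
    the two bounds are exactly the residual applied to \<open>p\<close>.\<close>
  have "blinfun_apply (f' xs - f' x - blinfun_apply (H x) (xs - x)) p
      = blinfun_apply (f' xs) p - blinfun_apply (f' x) d - blinfun_apply (f' x) u + blinfun_apply (blinfun_apply (H x) u) p"
    by (simp add: d blinfun.bilinear_simps)
  moreover have "blinfun_apply (f' xs - f' x - blinfun_apply (H x) (xs - x)) p \<le> e * norm u * norm p"
    using abs_blinfun_apply_le[OF err, of p] unfolding u_def by simp
  moreover have "\<omega> * inner u p \<le> \<omega> * (norm u * norm p)"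
    using \<omega> norm_cauchy_schwarz by (intro mult_left_mono)
  ultimately have "?m * (norm p)\<^sup>2 \<le> (e + \<omega>) * norm u * norm p"
    using 1 2 H[of p] unfolding model_def Hd nd xu
    by (simp add: blinfun.bilinear_simps algebra_simps add_divide_distrib diff_divide_distrib)
  then have "(?m * norm p) * norm p \<le> ((e + \<omega>) * norm u) * norm p"
    by (simp add: power2_eq_square mult.assoc)
  then have "?m * norm p \<le> (e + \<omega>) * norm u" if "p \<noteq> 0" using that by simp
  \<comment> \<open>Settles the case \<open>p = 0\<close>: the sign of \<open>e\<close> is not
    assumed but follows from the residual bound.\<close>
  moreover have "0 \<le> e * norm u" using order_trans[OF norm_ge_zero err] by (simp add: u_def)
  ultimately show ?thesis
    using \<omega> by (cases "p = 0") (auto simp: p_def u_def d_def distrib_right)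
qed

text \<open>Adding the growth bounds of \<open>g\<close> at \<open>x\<close> and at
  \<open>xs\<close> is strong monotonicity of the subdifferential. With the residual bound it makes
  \<open>- u\<close> a descent direction of slope at least \<open>?m / 2 * (norm u)\<^sup>2\<close>,
  and the minimizer does no worse than a trial step along it.\<close>

lemma subgradient_step_decrease:
  fixes g :: "'a::{real_inner, complete_space} \<Rightarrow> real"
  assumes cvx: "strongly_convex k g"
    and H: "\<And>v. blinfun_apply (blinfun_apply (H x) v) v \<ge> h * (norm v)\<^sup>2"
    and pos: "h + k > 0" and \<omega>: "0 < \<omega>" "\<omega> \<le> \<omega>max"
    and opt: "- f' xs \<in> frechet_subdifferential g xs"
    and \<mu>: "\<mu> \<in> frechet_subdifferential g x"
    and err: "norm (f' xs - f' x - blinfun_apply (H x) (xs - x)) \<le> (h + k) / 2 * norm (x - xs)"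
  shows "subgradient_model f' \<mu> x \<omega> (subgradient_step f' \<mu> x \<omega>)
           \<le> - (h + k)\<^sup>2 / (8 * \<omega>max) * (norm (x - xs))\<^sup>2"
proof -
  define u where "u = x - xs"
  let ?m = "h + k"
  have xu: "xs - x = - u" by (simp add: u_def)
  have 1: "g xs \<ge> g x - blinfun_apply \<mu> u + k / 2 * (norm u)\<^sup>2"
    using strongly_convex_subgradient_bound[OF cvx \<mu>, of xs] by (simp add: xu blinfun.minus_right)
  have 2: "g x \<ge> g xs - blinfun_apply (f' xs) u + k / 2 * (norm u)\<^sup>2"
    using strongly_convex_subgradient_bound[OF cvx opt, of x] by (simp add: u_def blinfun.minus_left)
  have "blinfun_apply (f' xs - f' x - blinfun_apply (H x) (xs - x)) u \<le> ?m / 2 * norm u * norm u"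
    using abs_blinfun_apply_le[OF err, of u] unfolding u_def by simp
  moreover have "blinfun_apply (f' xs - f' x - blinfun_apply (H x) (xs - x)) u
      = blinfun_apply (f' xs) u - blinfun_apply (f' x) u + blinfun_apply (blinfun_apply (H x) u) u"
    unfolding xu by (simp add: blinfun.bilinear_simps)
  ultimately have 3: "- (blinfun_apply (f' x) u + blinfun_apply \<mu> u) \<le> - ?m / 2 * (norm u)\<^sup>2"
    using 1 2 H[of u] by (simp add: power2_eq_square algebra_simps add_divide_distrib)
  \<comment> \<open>the minimizer of \<open>- t ?m / 2 + \<omega>max t\<^sup>2 / 2\<close>\<close>
  define t where "t = ?m / (2 * \<omega>max)"
  have t: "t > 0" using pos \<omega> by (simp add: t_def)
  have "subgradient_model f' \<mu> x \<omega> (subgradient_step f' \<mu> x \<omega>) \<le> subgradient_model f' \<mu> x \<omega> (- t *\<^sub>R u)"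
    using is_arg_min_subgradient_step[OF \<omega>(1), of f' \<mu> x] by (auto simp: is_arg_min_def not_less)
  also have "\<dots> = t * - (blinfun_apply (f' x) u + blinfun_apply \<mu> u) + \<omega> * (t\<^sup>2 / 2 * (norm u)\<^sup>2)"
    by (simp add: subgradient_model_def blinfun.bilinear_simps power_mult_distrib algebra_simps)
  \<comment> \<open>Replacing \<open>\<omega>\<close> by \<open>\<omega>max\<close> makes the
    decrease uniform in the regularization parameter.\<close>
  also have "\<dots> \<le> t * (- ?m / 2 * (norm u)\<^sup>2) + \<omega>max * (t\<^sup>2 / 2 * (norm u)\<^sup>2)"
    using 3 t \<omega> by (intro add_mono mult_left_mono mult_right_mono) auto
  also have "\<dots> = - ?m\<^sup>2 / (8 * \<omega>max) * (norm u)\<^sup>2"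
    using \<omega> by (simp add: t_def field_simps power2_eq_square)
  finally show ?thesis by (simp add: u_def)
qed

section \<open>Sufficient decrease near the solution\<close>

theorem proposition5p3:
  fixes f g F :: "'a::{real_inner, complete_space} \<Rightarrow> real"
    and f' :: "'a \<Rightarrow> ('a \<Rightarrow>\<^sub>L real)"
    and H :: "'a \<Rightarrow> ('a \<Rightarrow>\<^sub>L ('a \<Rightarrow>\<^sub>L real))"
    and L\<^sub>f \<kappa>\<^sub>1 \<kappa>\<^sub>2 \<omega> \<eta> \<omega>max \<gamma> :: real
    and xs :: 'a
    and \<Delta>s :: "'a \<Rightarrow> 'a"
  assumes F_def: "\<And>x. F x = f x + g x"
    and f_deriv: "\<And>x. (f has_derivative blinfun_apply (f' x)) (at x)"
    and f'_cont: "continuous_on UNIV f'"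
    and L\<^sub>f_pos: "L\<^sub>f > 0"
    and f'_lipschitz: "L\<^sub>f-lipschitz_on UNIV f'"
    and g_lsc: "lower_semicontinuous g"
    and g_convexity: "\<And>x y s. 0 \<le> s \<Longrightarrow> s \<le> 1 \<Longrightarrow>
          g (s *\<^sub>R x + (1 - s) *\<^sub>R y)
            \<le> s * g x + (1 - s) * g y - \<kappa>\<^sub>2 / 2 * s * (1 - s) * (norm (x - y))\<^sup>2"
    and H_symmetric: "\<And>x v w. blinfun_apply (blinfun_apply (H x) v) w
                             = blinfun_apply (blinfun_apply (H x) w) v"
    and H_bound: "\<forall>\<^sub>F x in nhds xs. \<forall>v.
          blinfun_apply (blinfun_apply (H x) v) v \<ge> \<kappa>\<^sub>1 * (norm v)\<^sup>2"
    and f'_semismooth: "semismooth_at f' H xs"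
    and xs_optimal: "is_arg_min F (\<lambda>_. True) xs"
    and kappa_pos: "\<kappa>\<^sub>1 + \<kappa>\<^sub>2 > 0"
    and omega_nonneg: "\<omega> \<ge> 0"
    and eta_nonneg: "\<eta> \<ge> 0"
    and omega_max_pos: "\<omega>max > 0"
    and inexact_1: "\<forall>\<^sub>F x in nhds xs.
          norm (exact_step f' H g x \<omega> - \<Delta>s x) \<le> \<eta> * norm (exact_step f' H g x \<omega>)"
    and inexact_2: "\<forall>\<^sub>F x in nhds xs.
          \<exists>\<mu> \<in> frechet_subdifferential g x. \<exists>\<omega>'. 0 < \<omega>' \<and> \<omega>' < \<omega>max \<and>
            model f' H g x \<omega> (\<Delta>s x) \<le> subgradient_model f' \<mu> x \<omega>' (subgradient_step f' \<mu> x \<omega>')"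
    and H_variation: "(\<lambda>x. blinfun_apply
            (blinfun_apply (H (x + \<Delta>s x) - H x) (x + \<Delta>s x - xs)) (x + \<Delta>s x - xs))
          \<in> o[at xs](\<lambda>x. (norm (x - xs))\<^sup>2)"
    and f_second_order: "second_order_semismooth_at f f' H xs"
    and gamma: "0 < \<gamma>" "\<gamma> < 1"
  shows "\<forall>\<^sub>F x in nhds xs. F (x + \<Delta>s x) - F x \<le> \<gamma> * model f' H g x \<omega> (\<Delta>s x)"
proof -
  have cvx: "strongly_convex \<kappa>\<^sub>2 g" using g_convexity by (simp add: strongly_convex_def)
  have opt: "- f' xs \<in> frechet_subdifferential g xs"
    using xs_optimal f_deriv
    by (intro minimizer_sum_subgradient[where f = f]) (auto simp: is_arg_min_def F_def)
  define k where "k = \<kappa>\<^sub>1 + \<kappa>\<^sub>2"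
  define R where "R \<xi> = f (xs + \<xi>) - (f xs + blinfun_apply (f' xs) \<xi>
            + 1/2 * blinfun_apply (blinfun_apply (H (xs + \<xi>)) \<xi>) \<xi>)" for \<xi>
  define V where "V x = blinfun_apply
            (blinfun_apply (H (x + \<Delta>s x) - H x) (x + \<Delta>s x - xs)) (x + \<Delta>s x - xs)" for x
  \<comment> \<open>\<open>C\<close> will bound the ratio of \<open>norm (\<Delta>s x)\<close> to
    \<open>norm (x - xs)\<close>: the fraction comes from \<open>exact_step_error_bound\<close> with
    \<open>e = k / 2\<close>, the inner 1 from the triangle inequality, and
    \<open>1 + \<eta>\<close> from the first inexactness criterion. \<open>D\<close> is the constant
    of \<open>subgradient_step_decrease\<close>.\<close>
  define C where "C = (1 + \<eta>) * (1 + (k / 2 + \<omega>) / (k + \<omega>))"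
  define D where "D = k\<^sup>2 / (8 * \<omega>max)"
  \<comment> \<open>The first bound makes the residual small enough for both step estimates. In the
    denominator, \<open>(1 + C)\<^sup>2\<close> pays for the remainder at \<open>u + d\<close>, the
    2 for the remainder at \<open>u\<close> and for the variation of \<open>H\<close>, and
    \<open>C\<close> for the residual applied to \<open>d\<close>.\<close>
  define e where "e = min (k / 2) ((1 - \<gamma>) * D / ((1 + C)\<^sup>2 + 2 + C))"
  have k: "k > 0" using kappa_pos by (simp add: k_def)
  have C: "C \<ge> 0" using k omega_nonneg eta_nonneg by (simp add: C_def)
  have D: "D > 0" using k omega_max_pos by (simp add: D_def)
  have den: "(1 + C)\<^sup>2 + 2 + C > 0" using C by (intro add_nonneg_pos add_pos_nonneg) auto
  have e: "e > 0" "e \<le> k / 2" using k D gamma den unfolding e_def by (simp, intro min.cobounded1)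
  have "e \<le> (1 - \<gamma>) * D / ((1 + C)\<^sup>2 + 2 + C)" by (simp add: e_def)
  then have e3: "e * ((1 + C)\<^sup>2 + 2 + C) \<le> (1 - \<gamma>) * D" using den by (simp add: pos_le_divide_eq)
  have err: "\<forall>\<^sub>F x in nhds xs. norm (f' xs - f' x - blinfun_apply (H x) (xs - x)) \<le> e * norm (x - xs)"
    using landau_o.smallD[OF f'_semismooth[unfolded semismooth_at_def] e(1)]
    by (auto simp: eventually_nhds_conv_at)
  have "\<forall>\<^sub>F \<xi> in at 0. \<bar>R \<xi>\<bar> \<le> e * (norm \<xi>)\<^sup>2"
    using landau_o.smallD[OF f_second_order[unfolded second_order_semismooth_at_def] e(1)]
    by (simp add: R_def)
  then have "\<forall>\<^sub>F \<xi> in nhds 0. \<bar>R \<xi>\<bar> \<le> e * (norm \<xi>)\<^sup>2"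
    by (simp add: eventually_nhds_conv_at R_def)
  then obtain r where r: "r > 0" "\<And>\<xi>. norm \<xi> < r \<Longrightarrow> \<bar>R \<xi>\<bar> \<le> e * (norm \<xi>)\<^sup>2"
    unfolding eventually_nhds_metric by auto
  \<comment> \<open>The point \<open>xs\<close> stays excluded: \<open>V xs\<close> vanishes only
    because the step at \<open>xs\<close> is zero, which is established later.\<close>
  have var: "\<forall>\<^sub>F x in nhds xs. x \<noteq> xs \<longrightarrow> \<bar>V x\<bar> \<le> e * (norm (x - xs))\<^sup>2"
    using landau_o.smallD[OF H_variation e(1)] by (simp add: V_def eventually_at_filter)
  \<comment> \<open>This radius keeps both \<open>u\<close> and \<open>u + d\<close> in the ball
    where the expansion of \<open>f\<close> is controlled.\<close>
  have "r / (1 + C) > 0" using r C by simp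
  then have near: "\<forall>\<^sub>F x in nhds xs. norm (x - xs) < r / (1 + C)"
    unfolding eventually_nhds_metric dist_norm by blast
  show ?thesis
    using err var near H_bound inexact_1 inexact_2
  proof eventually_elim
    case (elim x)
    define d where "d = \<Delta>s x"
    define u where "u = x - xs"
    define n where "n = norm u"
    define \<Delta> where "\<Delta> = exact_step f' H g x \<omega>"
    have n: "n \<ge> 0" by (simp add: n_def)
    have errk: "norm (f' xs - f' x - blinfun_apply (H x) (xs - x)) \<le> k / 2 * norm (x - xs)"
      using elim(1) mult_right_mono[OF e(2) norm_ge_zero[of "x - xs"]] by linarith
    have "(\<kappa>\<^sub>1 + \<kappa>\<^sub>2 + \<omega>) * norm (x + \<Delta> - xs) \<le> (k / 2 + \<omega>) * norm (x - xs)"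
      unfolding \<Delta>_def
      using cvx g_lsc H_symmetric elim(4) kappa_pos omega_nonneg opt errk
      by (intro exact_step_error_bound) auto
    then have "norm (x + \<Delta> - xs) \<le> (k / 2 + \<omega>) / (k + \<omega>) * n"
      using k omega_nonneg by (simp add: k_def n_def u_def field_simps)
    moreover have "norm \<Delta> \<le> norm (x + \<Delta> - xs) + n"
      using norm_triangle_ineq4[of "x + \<Delta> - xs" u] by (simp add: u_def n_def)
    ultimately have \<Delta>: "norm \<Delta> \<le> (1 + (k / 2 + \<omega>) / (k + \<omega>)) * n" by (simp add: distrib_right)
    have "norm d \<le> norm (\<Delta> - d) + norm \<Delta>"
      using norm_triangle_ineq4[of \<Delta> "\<Delta> - d"] by simp
    also have "\<dots> \<le> (1 + \<eta>) * norm \<Delta>" using elim(5) by (simp add: \<Delta>_def d_def distrib_right)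
    also have "\<dots> \<le> C * n"
      using mult_left_mono[OF \<Delta>, of "1 + \<eta>"] eta_nonneg by (simp add: C_def mult.assoc)
    finally have dC: "norm d \<le> C * n" .
    have ud: "norm (u + d) \<le> (1 + C) * n"
      using norm_triangle_ineq[of u d] dC by (simp add: n_def distrib_right)
    have n_r: "(1 + C) * n < r" using elim(3) C by (simp add: n_def u_def field_simps)
    have "n \<le> (1 + C) * n" using C n by (simp add: distrib_right)
    then have R1: "\<bar>R u\<bar> \<le> e * n\<^sup>2" using r(2)[of u] n_r by (simp add: n_def)
    have "\<bar>R (u + d)\<bar> \<le> e * (norm (u + d))\<^sup>2" using r(2)[of "u + d"] ud n_r by simp
    also have "\<dots> \<le> e * ((1 + C) * n)\<^sup>2" using e ud by (intro mult_left_mono power_mono) auto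
    finally have R2: "\<bar>R (u + d)\<bar> \<le> e * ((1 + C)\<^sup>2 * n\<^sup>2)" by (simp add: power_mult_distrib)
    have V: "\<bar>V x\<bar> \<le> e * n\<^sup>2"
    proof (cases "x = xs")
      case True
      then have "d = 0" using dC by (simp add: n_def u_def)
      then show ?thesis using True e n by (simp add: V_def d_def)
    next
      case False
      then show ?thesis using elim(2) by (simp add: n_def u_def)
    qed
    define E where "E = blinfun_apply (f' xs - f' x - blinfun_apply (H x) (xs - x)) d"
    have "\<bar>E\<bar> \<le> (e * n) * norm d"
      unfolding E_def n_def u_def by (rule abs_blinfun_apply_le[OF elim(1)])
    also have "\<dots> \<le> (e * n) * (C * n)"
      using dC e n by (intro mult_left_mono) auto
    finally have E: "\<bar>E\<bar> \<le> e * (C * n\<^sup>2)" by (simp add: power2_eq_square algebra_simps)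
    have eqs: "xs + (u + d) = x + d" "xs + u = x" "x + d - xs = u + d" "xs - x = - u"
      by (auto simp: u_def)
    have sym: "blinfun_apply (blinfun_apply (H x) d) u = blinfun_apply (blinfun_apply (H x) u) d"
      by (rule H_symmetric)
    \<comment> \<open>An exact identity: \<open>V x\<close> exchanges the Hessian at
      \<open>x + d\<close> for the one at \<open>x\<close>, and \<open>E\<close> absorbs the cross
      term of \<open>H x\<close> in \<open>u\<close> and \<open>d\<close> together with the change
      from \<open>f' xs\<close> to \<open>f' x\<close>.\<close>
    have "F (x + d) - F x = model f' H g x \<omega> d - \<omega> / 2 * (norm d)\<^sup>2 + R (u + d) - R u + V x / 2 + E"
      unfolding F_def model_def R_def V_def E_def d_def[symmetric] eqs
      using sym by (simp add: blinfun.bilinear_simps algebra_simps add_divide_distrib diff_divide_distrib)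
    also have "\<dots> \<le> model f' H g x \<omega> d + e * ((1 + C)\<^sup>2 + 2 + C) * n\<^sup>2"
    proof -
      have "0 \<le> \<omega> / 2 * (norm d)\<^sup>2" "0 \<le> e * n\<^sup>2" using omega_nonneg e by auto
      then show ?thesis using R1 R2 V E by (simp add: algebra_simps)
    qed
    also have "\<dots> \<le> model f' H g x \<omega> d + (1 - \<gamma>) * D * n\<^sup>2"
      using e3 by (intro add_left_mono mult_right_mono) auto
    finally have 1: "F (x + d) - F x \<le> model f' H g x \<omega> d + (1 - \<gamma>) * D * n\<^sup>2" .
    obtain \<mu> \<omega>' where \<mu>: "\<mu> \<in> frechet_subdifferential g x" "0 < \<omega>'" "\<omega>' < \<omega>max"
      "model f' H g x \<omega> d \<le> subgradient_model f' \<mu> x \<omega>' (subgradient_step f' \<mu> x \<omega>')"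
      using elim(6) unfolding d_def by blast
    have "subgradient_model f' \<mu> x \<omega>' (subgradient_step f' \<mu> x \<omega>')
        \<le> - (\<kappa>\<^sub>1 + \<kappa>\<^sub>2)\<^sup>2 / (8 * \<omega>max) * (norm (x - xs))\<^sup>2"
      using cvx elim(4) kappa_pos \<mu> opt errk
      by (intro subgradient_step_decrease[where H = H]) (auto simp: k_def)
    then have "model f' H g x \<omega> d \<le> - (D * n\<^sup>2)" using \<mu>(4) by (simp add: D_def k_def n_def u_def)
    \<comment> \<open>The error \<open>(1 - \<gamma>) * D * n\<^sup>2\<close> is thus at most
      \<open>- (1 - \<gamma>)\<close> times the model value, which leaves the factor
      \<open>\<gamma>\<close>.\<close>
    then have "(1 - \<gamma>) * model f' H g x \<omega> d \<le> (1 - \<gamma>) * - (D * n\<^sup>2)"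
      using gamma by (intro mult_left_mono) auto
    then show ?case using 1 by (simp add: d_def algebra_simps)
  qed
qed

end
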